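(* Let $\mathcal{M}$ be the linear operator on $\mathbb{R}^{I_1\times\cdots\times I_N}$ given by $\mathcal{M}(\mathscr{X})=\mathscr{X}-\mathscr{X}\times_1A^{(1)}\times_2A^{(2)}\cdots\times_NA^{(N)}$ with $A^{(n)}\in\mathbb{R}^{I_n\times I_n}$, let $\mathscr{F}\in\mathbb{R}^{I_1\times\cdots\times I_N}$, and let $k\ge1$. Suppose the tensor Golub--Kahan bidiagonalization process (GKB_BTF, described in the context) applied to $\mathcal{M}$ and $\mathscr{F}$ with $m=k+1$ does not break down; let $\beta_1=\|\mathscr{F}\|$, let $\bar T_k$ be the associated $(k+1)\times k$ lower bidiagonal matrix, and let $\tilde{\mathscr{V}}_k$ be the $(N+1)$-mode tensor with frontal slices $\mathscr{V}_1,\ldots,\mathscr{V}_k$ computed by the process. For $\mu>0$ define $$\phi_k(\mu)=\beta_1^2\,e_1^T\left(\mu^{-1}\bar T_k\bar T_k^T+I\right)^{-2}e_1 .$$ Let $\eta$ and $\epsilon$ be positive constants with $\eta>1$. Then any $\mu>0$ satisfying $$\epsilon^2\le\phi_k(\mu)\le\eta^2\epsilon^2$$ determines a solution $y_{k,\mu}$ of the minimization problem $$\min_{y\in\mathbb{R}^k}\left\{\|\bar T_ky-\beta_1e_1\|_2^2+\mu\|y\|_2^2\right\}$$ such that $$\epsilon\le\|\bar T_ky_{k,\mu}-\beta_1e_1\|_2\le\eta\epsilon,$$ and $\mathscr{X}_{k,\mu}=\tilde{\mathscr{V}}_k\,\bar\times_{(N+1)}\,y_{k,\mu}$ satisfies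 $$\epsilon\le\|\mathcal{M}(\mathscr{X}_{k,\mu})-\mathscr{F}\|\le\eta\epsilon.$$
   Context: The $n$-mode product of $\mathscr{X}\in\mathbb{R}^{I_1\times\cdots\times I_N}$ with $U\in\mathbb{R}^{J\times I_n}$ is the tensor of size $I_1\times\cdots\times I_{n-1}\times J\times I_{n+1}\times\cdots\times I_N$ with entries $(\mathscr{X}\times_nU)_{i_1\cdots i_{n-1}ji_{n+1}\cdots i_N}=\sum_{i_n=1}^{I_n}x_{i_1i_2\cdots i_N}u_{ji_n}$. The frontal slices of an $(N+1)$-mode tensor are the $N$-mode tensors obtained by fixing its last index. If $\tilde{\mathscr{V}}_k$ has frontal slices $\mathscr{V}_1,\ldots,\mathscr{V}_k$ and $y=(y_1,\ldots,y_k)^T$, then $\tilde{\mathscr{V}}_k\bar\times_{(N+1)}y=\sum_{j=1}^ky_j\mathscr{V}_j$. The norm $\|\mathscr{X}\|$ on tensors is induced by the inner product $\langle\mathscr{X},\mathscr{Y}\rangle=\sum x_{i_1\cdots i_N}y_{i_1\cdots i_N}$. The adjoint of $\mathcal{M}$ is $\mathcal{M}^*(\mathscr{Y})=\mathscr{Y}-\mathscr{Y}\times_1(A^{(1)})^T\times_2(A^{(2)})^T\cdots\times_N(A^{(N)})^T$. GKB_BTF process with input $\mathcal{M}$, $\mathscr{F}$ and number $m$: set $\beta_1=\|\mathscr{F}\|$, $\mathscr{V}_1=\mathscr{F}/\beta_1$, $\mathscr{U}=\mathcal{M}^*(\mathscr{V}_1)$, $\alpha_1=\|\mathscr{U}\|$,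 $\mathscr{U}_1=\mathscr{U}/\alpha_1$. For $j=2,\ldots,m$: $\mathscr{V}=\mathcal{M}(\mathscr{U}_{j-1})-\alpha_{j-1}\mathscr{V}_{j-1}$, $\beta_j=\|\mathscr{V}\|$ (stop if $\beta_j=0$), $\mathscr{V}_j=\mathscr{V}/\beta_j$; $\mathscr{U}=\mathcal{M}^*(\mathscr{V}_j)-\beta_j\mathscr{U}_{j-1}$, $\alpha_j=\|\mathscr{U}\|$ (stop if $\alpha_j=0$), $\mathscr{U}_j=\mathscr{U}/\alpha_j$. No break-down means that $\alpha_j\neq0$ and $\beta_j\neq0$ for all $j=1,\ldots,m$. $\bar T_k$ is the $(k+1)\times k$ lower bidiagonal matrix with $(\bar T_k)_{jj}=\alpha_j$ and $(\bar T_k)_{j+1,j}=\beta_{j+1}$ for $j=1,\ldots,k$ and all other entries zero. In all formulas $e_1$ is the first column of the identity matrix $I$ of order $k+1$, and $\|\cdot\|_2$ is the Euclidean norm.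
   Formalization: The iterate X_{k,μ} is built from the tensors U_1,…,U_k of the process instead of V_1,…,V_k; with the V_j the last bounds fail, e.g. for N=k=1, M=[[0,1],[1,1]], F=(1,0), μ=1, ε²=5/9, η=6/5. *)

theory Defs
  imports Complex_Main "Jordan_Normal_Form.Gauss_Jordan_Elimination"
begin

section \<open>Tensors\<close>

text \<open>
  A real tensor of size \<open>I\<^sub>1 \<times> \<dots> \<times> I\<^sub>N\<close> is a function on multi-indices that vanishes outside the
  index set given by the list \<open>I = [I\<^sub>1, \<dots>, I\<^sub>N]\<close>. Indices and modes are counted from 0, as for the
  entries of matrices and vectors, so that mode \<open>n\<close> below is the mode \<open>n + 1\<close> of the usual notation.
\<close>

type_synonym tensor = "nat list \<Rightarrow> real"

definition multi_indices :: "nat list \<Rightarrow> nat list set" where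
  "multi_indices I = {i. length i = length I \<and> (\<forall>n < length I. i ! n < I ! n)}"

definition carrier_tensor :: "nat list \<Rightarrow> tensor set" where
  "carrier_tensor I = {X. \<forall>i. i \<notin> multi_indices I \<longrightarrow> X i = 0}"

definition tensor_inner :: "nat list \<Rightarrow> tensor \<Rightarrow> tensor \<Rightarrow> real" where
  "tensor_inner I X Y = (\<Sum>i\<in>multi_indices I. X i * Y i)"

definition tensor_norm :: "nat list \<Rightarrow> tensor \<Rightarrow> real" where
  "tensor_norm I X = sqrt (tensor_inner I X X)"

definition tensor_minus :: "tensor \<Rightarrow> tensor \<Rightarrow> tensor" where
  "tensor_minus X Y = (\<lambda>i. X i - Y i)"

definition tensor_scale :: "real \<Rightarrow> tensor \<Rightarrow> tensor" where
  "tensor_scale c X = (\<lambda>i. c * X i)"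

text \<open>
  For \<open>X\<close> of size \<open>I\<close> and \<open>U \<in> \<real>\<^bsup>J \<times> I\<^sub>n\<^esup>\<close>, the result has size \<open>I[n := J]\<close>.
\<close>

definition mode_product :: "nat list \<Rightarrow> nat \<Rightarrow> tensor \<Rightarrow> real mat \<Rightarrow> tensor" where
  "mode_product I n X U =
     (\<lambda>i. if i \<in> multi_indices (I[n := dim_row U])
          then \<Sum>l < I ! n. X (i[n := l]) * U $$ (i ! n, l) else 0)"

text \<open>
  \<open>X \<times>\<^sub>1 A\<^sub>1 \<times>\<^sub>2 A\<^sub>2 \<dots> \<times>\<^sub>N A\<^sub>N\<close> for square factors, which leave the size \<open>I\<close> unchanged.
\<close>

definition multi_mode_product :: "nat list \<Rightarrow> real mat list \<Rightarrow> tensor \<Rightarrow> tensor" where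
  "multi_mode_product I A X = foldl (\<lambda>Y n. mode_product I n Y (A ! n)) X [0..<length I]"

definition stein_op :: "nat list \<Rightarrow> real mat list \<Rightarrow> tensor \<Rightarrow> tensor" where
  "stein_op I A X = tensor_minus X (multi_mode_product I A X)"

definition stein_adjoint :: "nat list \<Rightarrow> real mat list \<Rightarrow> tensor \<Rightarrow> tensor" where
  "stein_adjoint I A Y = tensor_minus Y (multi_mode_product I (map transpose_mat A) Y)"

text \<open>
  An \<open>(N+1)\<close>-mode tensor given by its frontal slices, and its contraction with a vector in the last
  mode.
\<close>

definition frontal_slice :: "tensor \<Rightarrow> nat \<Rightarrow> tensor" where
  "frontal_slice W j = (\<lambda>i. W (i @ [j]))"

definition tensor_of_slices :: "nat list \<Rightarrow> nat \<Rightarrow> (nat \<Rightarrow> tensor) \<Rightarrow> tensor" where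
  "tensor_of_slices I k S =
     (\<lambda>i. if i \<in> multi_indices (I @ [k]) then S (last i) (butlast i) else 0)"

definition contract_last :: "tensor \<Rightarrow> real vec \<Rightarrow> tensor" where
  "contract_last W y = (\<lambda>i. \<Sum>j < dim_vec y. y $ j * frontal_slice W j i)"

section \<open>The tensor Golub--Kahan bidiagonalization\<close>

text \<open>
  \<open>gkb_step I M M' F j\<close> is the quadruple \<open>(\<beta>, V, \<alpha>, U)\<close> computed in step \<open>j + 1\<close> of the process, where
  \<open>M'\<close> is the adjoint of \<open>M\<close>. Instead of stopping at a zero norm, the recursion goes on with
  \<open>1 / 0 = 0\<close>; the values are only meaningful as long as there is no break-down.
\<close>

primrec gkb_step ::
  "nat list \<Rightarrow> (tensor \<Rightarrow> tensor) \<Rightarrow> (tensor \<Rightarrow> tensor) \<Rightarrow> tensor \<Rightarrow> nat \<Rightarrow> real \<times> tensor \<times> real \<times> tensor"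
where
  "gkb_step I M M' F 0 =
     (let \<beta> = tensor_norm I F;
          V = tensor_scale (1 / \<beta>) F;
          U = M' V;
          \<alpha> = tensor_norm I U
      in (\<beta>, V, \<alpha>, tensor_scale (1 / \<alpha>) U))"
| "gkb_step I M M' F (Suc j) =
     (case gkb_step I M M' F j of (\<beta>\<^sub>0, V\<^sub>0, \<alpha>\<^sub>0, U\<^sub>0) \<Rightarrow>
      let W = tensor_minus (M U\<^sub>0) (tensor_scale \<alpha>\<^sub>0 V\<^sub>0);
          \<beta> = tensor_norm I W;
          V = tensor_scale (1 / \<beta>) W;
          U = tensor_minus (M' V) (tensor_scale \<beta> U\<^sub>0);
          \<alpha> = tensor_norm I U
      in (\<beta>, V, \<alpha>, tensor_scale (1 / \<alpha>) U))"

text \<open>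
  The scalars and tensors carry the usual indices \<open>1, 2, \<dots>\<close> of the process; the index \<open>0\<close> is unused.
\<close>

definition gkb_beta where "gkb_beta I M M' F j = fst (gkb_step I M M' F (j - 1))"
definition gkb_V where "gkb_V I M M' F j = fst (snd (gkb_step I M M' F (j - 1)))"
definition gkb_alpha where "gkb_alpha I M M' F j = fst (snd (snd (gkb_step I M M' F (j - 1))))"
definition gkb_U where "gkb_U I M M' F j = snd (snd (snd (gkb_step I M M' F (j - 1))))"

definition gkb_no_breakdown where
  "gkb_no_breakdown I M M' F m \<longleftrightarrow>
     (\<forall>j\<in>{1..m}. gkb_alpha I M M' F j \<noteq> 0 \<and> gkb_beta I M M' F j \<noteq> 0)"

text \<open>
  In row \<open>i\<close> and column \<open>j\<close>, counted from 0, stands the entry in row \<open>i + 1\<close> and column \<open>j + 1\<close> of the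
  usual notation.
\<close>

definition gkb_T where
  "gkb_T I M M' F k = mat (k + 1) k
     (\<lambda>(i, j). if i = j then gkb_alpha I M M' F (j + 1)
               else if i = j + 1 then gkb_beta I M M' F (j + 2) else 0)"

text \<open>
  The iterate is expanded in \<open>\<U>\<^sub>1, \<dots>, \<U>\<^sub>k\<close>. This deviates on purpose from the source, which writes
  \<open>\<V>\<^sub>1, \<dots>, \<V>\<^sub>k\<close>: the recursion gives \<open>M \<U>\<^sub>j = \<alpha>\<^sub>j \<V>\<^sub>j + \<beta>\<^sub>j\<^sub>+\<^sub>1 \<V>\<^sub>j\<^sub>+\<^sub>1\<close>, so it is the expansion in the \<open>\<U>\<^sub>j\<close> whose
  residual has the coordinates \<open>T y - \<beta>\<^sub>1 e\<^sub>1\<close>. With the \<open>\<V>\<^sub>j\<close> the residual bounds fail already for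
  \<open>N = k = 1\<close>, \<open>\<mu> = 1\<close>, \<open>F = (1, 0)\<close> and the symmetric operator with rows \<open>(0, 1)\<close> and \<open>(1, 1)\<close>: there
  \<open>y = 1 / 3\<close> and \<open>\<phi> = 5 / 9\<close>, whereas the squared residual of \<open>y \<V>\<^sub>1\<close> is \<open>10 / 9\<close>.
\<close>

definition gkb_iterate where
  "gkb_iterate I M M' F k y =
     contract_last (tensor_of_slices I k (\<lambda>j. gkb_U I M M' F (j + 1))) y"

section \<open>The projected Tikhonov problem\<close>

definition euclid_norm :: "real vec \<Rightarrow> real" where
  "euclid_norm v = sqrt (v \<bullet> v)"

definition tikhonov_functional :: "real mat \<Rightarrow> real \<Rightarrow> real \<Rightarrow> real vec \<Rightarrow> real" where
  "tikhonov_functional T b \<mu> y =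
     (euclid_norm (T *\<^sub>v y - b \<cdot>\<^sub>v unit_vec (dim_row T) 0))\<^sup>2 + \<mu> * (euclid_norm y)\<^sup>2"

text \<open>
  For \<open>\<mu> > 0\<close> the matrix \<open>\<mu>\<^sup>-\<^sup>1 T T\<^sup>t + 1\<close> is positive definite, so \<open>mat_inverse\<close> is not \<open>None\<close>.
\<close>

definition tikhonov_phi :: "real mat \<Rightarrow> real \<Rightarrow> real \<Rightarrow> real" where
  "tikhonov_phi T b \<mu> =
     (let n = dim_row T;
          B = the (mat_inverse (inverse \<mu> \<cdot>\<^sub>m (T * transpose_mat T) + 1\<^sub>m n))
      in b\<^sup>2 * (unit_vec n 0 \<bullet> ((B ^\<^sub>m 2) *\<^sub>v unit_vec n 0)))"

end

theory Submission
  imports Defs "Jordan_Normal_Form.Determinant"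
begin

text \<open>
  Put \<open>B = \<mu>\<^sup>-\<^sup>1 T T\<^sup>t + 1\<close> and \<open>z = \<beta>\<^sub>1 B\<^sup>-\<^sup>1 e\<^sub>1\<close>. Then \<open>y = \<mu>\<^sup>-\<^sup>1 T\<^sup>t z\<close> satisfies \<open>T y - \<beta>\<^sub>1 e\<^sub>1 = - z\<close>,
  which makes it a solution of the normal equations, hence the unique minimizer of the strictly convex
  functional, and gives its squared residual as \<open>z \<bullet> z\<close>, which is \<open>\<phi>(\<mu>)\<close> because \<open>B\<close> is symmetric.
  The recurrences of the process give \<open>M \<U>\<^sub>j = \<alpha>\<^sub>j \<V>\<^sub>j + \<beta>\<^sub>j\<^sub>+\<^sub>1 \<V>\<^sub>j\<^sub>+\<^sub>1\<close> and \<open>F = \<beta>\<^sub>1 \<V>\<^sub>1\<close>, so that the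
  residual of the iterate has the coordinates \<open>T y - \<beta>\<^sub>1 e\<^sub>1\<close> in the family of the \<open>\<V>\<^sub>j\<close>. This family is
  orthonormal because \<open>M'\<close> is the adjoint of \<open>M\<close>.
\<close>

section \<open>The projected Tikhonov problem\<close>

lemma euclid_norm_sq: "(euclid_norm v)\<^sup>2 = v \<bullet> v"
  by (simp add: euclid_norm_def scalar_prod_def sum_nonneg)

lemma euclid_norm_nonneg: "euclid_norm v \<ge> 0"
  by (simp add: euclid_norm_def scalar_prod_def sum_nonneg)

lemma scalar_prod_self_eq_0:
  fixes v :: "real vec"
  assumes "v \<bullet> v = 0" "v \<in> carrier_vec n"
  shows "v = 0\<^sub>v n"
proof (intro eq_vecI)
  fix i assume "i < dim_vec (0\<^sub>v n :: real vec)"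
  then show "v $ i = 0\<^sub>v n $ i"
    using assms by (auto simp: scalar_prod_def sum_nonneg_eq_0_iff)
qed (use assms in auto)

section \<open>The shifted Gram matrix \<open>c T T^t + 1\<close>, its quadratic form and its
  inverse\<close>

lemma shifted_gram_mult_vec:
  fixes T :: "real mat"
  assumes T: "T \<in> carrier_mat n k" and z: "z \<in> carrier_vec n"
  shows "(c \<cdot>\<^sub>m (T * transpose_mat T) + 1\<^sub>m n) *\<^sub>v z = c \<cdot>\<^sub>v (T *\<^sub>v (transpose_mat T *\<^sub>v z)) + z"
proof -
  have TT: "T * transpose_mat T \<in> carrier_mat n n" using T by auto
  have "(c \<cdot>\<^sub>m (T * transpose_mat T)) *\<^sub>v z = c \<cdot>\<^sub>v ((T * transpose_mat T) *\<^sub>v z)"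
    using TT z by (intro eq_vecI) (auto simp del: index_mult_mat)
  also have "(T * transpose_mat T) *\<^sub>v z = T *\<^sub>v (transpose_mat T *\<^sub>v z)"
    using T z by auto
  finally show ?thesis
    using T z TT by (subst add_mult_distrib_mat_vec[of _ n n]) auto
qed

text \<open>The right-hand side is symmetric in \<open>v\<close> and \<open>w\<close>, and for
  \<open>w = v\<close> and \<open>c > 0\<close> it is a positive definite form. The first fact
  serves as symmetry of \<open>B\<close>, the second yields its invertibility.\<close>

lemma shifted_gram_self_adjoint:
  fixes T :: "real mat" and c :: real
  assumes T: "T \<in> carrier_mat n k" and v: "v \<in> carrier_vec n" and w: "w \<in> carrier_vec n"
  defines "B \<equiv> c \<cdot>\<^sub>m (T * transpose_mat T) + 1\<^sub>m n"
  shows "(B *\<^sub>v v) \<bullet> w = c * ((transpose_mat T *\<^sub>v v) \<bullet> (transpose_mat T *\<^sub>v w)) + v \<bullet> w"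
proof -
  have "(T *\<^sub>v (transpose_mat T *\<^sub>v v)) \<bullet> w = w \<bullet> (T *\<^sub>v (transpose_mat T *\<^sub>v v))"
    using T v w by (intro comm_scalar_prod[of _ n]) auto
  also have "\<dots> = (transpose_mat T *\<^sub>v w) \<bullet> (transpose_mat T *\<^sub>v v)"
    using T v w by (intro transpose_vec_mult_scalar[symmetric]) auto
  also have "\<dots> = (transpose_mat T *\<^sub>v v) \<bullet> (transpose_mat T *\<^sub>v w)"
    using T v w by (intro comm_scalar_prod[of _ k]) auto
  finally show ?thesis
    unfolding B_def shifted_gram_mult_vec[OF T v]
    using T v w by (subst add_scalar_prod_distrib[of _ n]) auto
qed

text \<open>If \<open>B v = 0\<close>, then \<open>c |T^t v|^2 + |v|^2 = 0\<close>, so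
  \<open>v = 0\<close>; hence the determinant is nonzero. This also gives meaning to the use of
  \<open>the\<close> in \<open>tikhonov_phi\<close>.\<close>

lemma mat_inverse_shifted_gram:
  fixes T :: "real mat" and c :: real
  assumes T: "T \<in> carrier_mat n k" and c: "c > 0"
  defines "B \<equiv> c \<cdot>\<^sub>m (T * transpose_mat T) + 1\<^sub>m n"
  obtains S where "mat_inverse B = Some S" "B * S = 1\<^sub>m n" "S \<in> carrier_mat n n"
proof -
  have B: "B \<in> carrier_mat n n" using T unfolding B_def by auto
  have "det B \<noteq> 0"
  proof
    assume "det B = 0"
    then obtain v where v: "v \<in> carrier_vec n" "v \<noteq> 0\<^sub>v n" "B *\<^sub>v v = 0\<^sub>v n"
      using det_0_iff_vec_prod_zero[OF B] by auto
    define u where "u = transpose_mat T *\<^sub>v v"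
    have "0 = c * (u \<bullet> u) + v \<bullet> v"
      using shifted_gram_self_adjoint[OF T v(1) v(1), of c] v unfolding B_def u_def by simp
    moreover have "c * (u \<bullet> u) \<ge> 0" "v \<bullet> v \<ge> 0"
      using c by (auto simp: scalar_prod_def sum_nonneg intro!: mult_nonneg_nonneg)
    ultimately have "v \<bullet> v = 0" by linarith
    with v scalar_prod_self_eq_0 show False by blast
  qed
  then have "B \<in> Units (ring_mat TYPE(real) n ())"
    by (rule det_non_zero_imp_unit[OF B])
  then show ?thesis
    using mat_inverse(1)[OF B, of "()"] mat_inverse(2)[OF B] that by (cases "mat_inverse B") auto
qed

text \<open>Completing the square around \<open>y\<close>: the assumption \<open>normal\<close> is
  the normal equation \<open>T^t r + \<mu> y = 0\<close>, under which the terms linear in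
  \<open>w - y\<close> cancel.\<close>

lemma tikhonov_functional_expand:
  fixes T :: "real mat" and b :: real
  assumes T: "T \<in> carrier_mat n k" and y: "y \<in> carrier_vec k" and w: "w \<in> carrier_vec k"
  defines "r \<equiv> T *\<^sub>v y - b \<cdot>\<^sub>v unit_vec n 0"
  assumes normal: "transpose_mat T *\<^sub>v r = (- \<mu>) \<cdot>\<^sub>v y"
  shows "tikhonov_functional T b \<mu> w =
    tikhonov_functional T b \<mu> y + (euclid_norm (T *\<^sub>v (w - y)))\<^sup>2 + \<mu> * (euclid_norm (w - y))\<^sup>2"
proof -
  define d where "d = w - y"
  have d: "d \<in> carrier_vec k" using y w by (simp add: d_def)
  have r: "r \<in> carrier_vec n" using T y by (auto simp: r_def)
  have Td: "T *\<^sub>v d \<in> carrier_vec n" using T d by auto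
  have wd: "w = y + d" using y w by (auto simp: d_def)
  have res: "T *\<^sub>v w - b \<cdot>\<^sub>v unit_vec n 0 = r + T *\<^sub>v d"
    unfolding wd mult_add_distrib_mat_vec[OF T y d] r_def
    using T y d by (intro eq_vecI) auto
  have "r \<bullet> (T *\<^sub>v d) = (transpose_mat T *\<^sub>v r) \<bullet> d"
    by (rule transpose_vec_mult_scalar[OF T d r, symmetric])
  also have "\<dots> = - \<mu> * (y \<bullet> d)"
    unfolding normal using y d by auto
  finally have cross: "r \<bullet> (T *\<^sub>v d) = - \<mu> * (y \<bullet> d)" .
  have sq: "(u + v) \<bullet> (u + v) = u \<bullet> u + 2 * (u \<bullet> v) + v \<bullet> v"
    if "u \<in> carrier_vec m" "v \<in> carrier_vec m" for u v :: "real vec" and m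
    using that comm_scalar_prod[OF that]
    by (simp add: add_scalar_prod_distrib[of _ m] scalar_prod_add_distrib[of _ m])
  have n: "dim_row T = n" using T by auto
  show ?thesis
    unfolding tikhonov_functional_def n res r_def[symmetric] d_def[symmetric] euclid_norm_sq
    unfolding wd sq[OF r Td] sq[OF y d] cross
    by (simp add: algebra_simps)
qed

lemma tikhonov_unique_minimizer:
  fixes T :: "real mat"
  assumes T: "T \<in> carrier_mat n k" and \<mu>: "\<mu> > 0"
  obtains y where "y \<in> carrier_vec k"
    and "(euclid_norm (T *\<^sub>v y - b \<cdot>\<^sub>v unit_vec n 0))\<^sup>2 = tikhonov_phi T b \<mu>"
    and "\<forall>w. is_arg_min (tikhonov_functional T b \<mu>) (\<lambda>y. y \<in> carrier_vec k) w \<longleftrightarrow> w = y"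
proof -
  define e c where "e = (unit_vec n 0 :: real vec)" and "c = b \<cdot>\<^sub>v e"
  define B where "B = inverse \<mu> \<cdot>\<^sub>m (T * transpose_mat T) + 1\<^sub>m n"
  have e: "e \<in> carrier_vec n" and cc: "c \<in> carrier_vec n" by (auto simp: e_def c_def)
  have B: "B \<in> carrier_mat n n" using T by (auto simp: B_def)
  obtain S where S: "mat_inverse B = Some S" "B * S = 1\<^sub>m n" "S \<in> carrier_mat n n"
    using mat_inverse_shifted_gram[OF T, of "inverse \<mu>"] \<mu> unfolding B_def by auto
  have BS: "B *\<^sub>v (S *\<^sub>v v) = v" if "v \<in> carrier_vec n" for v
    using assoc_mult_mat_vec[OF B S(3) that] S(2) that by simp
  \<comment> \<open>This \<open>y\<close> is \<open>(T^t T + \<mu>)^-1 T^t c\<close>, written with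
    the inverse of the \<open>n\<close> by \<open>n\<close> matrix \<open>B\<close> because that is
    the inverse occurring in \<open>tikhonov_phi\<close>.\<close>
  define z y where "z = S *\<^sub>v c" and "y = inverse \<mu> \<cdot>\<^sub>v (transpose_mat T *\<^sub>v z)"
  have z: "z \<in> carrier_vec n" using S(3) cc by (simp add: z_def)
  have y: "y \<in> carrier_vec k" using T z by (simp add: y_def)
  have Ttz: "transpose_mat T *\<^sub>v z \<in> carrier_vec k" using T z by simp
  have Bz: "B *\<^sub>v z = c" unfolding z_def by (rule BS[OF cc])
  have "T *\<^sub>v y = inverse \<mu> \<cdot>\<^sub>v (T *\<^sub>v (transpose_mat T *\<^sub>v z))"
    unfolding y_def by (rule mult_mat_vec[OF T Ttz])
  then have Ty: "T *\<^sub>v y + z = c"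
    using Bz shifted_gram_mult_vec[OF T z] by (simp add: B_def)
  have res: "T *\<^sub>v y - c = (- 1) \<cdot>\<^sub>v z"
    unfolding Ty[symmetric] using T y z by (intro eq_vecI) auto
  have "transpose_mat T *\<^sub>v (T *\<^sub>v y - c) = (- 1) \<cdot>\<^sub>v (transpose_mat T *\<^sub>v z)"
    unfolding res using T z by (intro mult_mat_vec) auto
  also have "\<dots> = (- \<mu>) \<cdot>\<^sub>v y"
    using \<mu> T by (intro eq_vecI) (auto simp: y_def)
  finally have normal: "transpose_mat T *\<^sub>v (T *\<^sub>v y - c) = (- \<mu>) \<cdot>\<^sub>v y" .
  note expand = tikhonov_functional_expand[OF T y _ normal[unfolded c_def e_def]]
  \<comment> \<open>Strictness comes from the term
    \<open>\<mu> * (euclid_norm (w - y))\<^sup>2\<close>, which is positive even if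
    \<open>w - y\<close> lies in the kernel of \<open>T\<close>.\<close>
  have less: "tikhonov_functional T b \<mu> y < tikhonov_functional T b \<mu> w"
    if w: "w \<in> carrier_vec k" and ne: "w \<noteq> y" for w
  proof -
    have wy: "w - y \<in> carrier_vec k" using w y by simp
    have "w - y \<noteq> 0\<^sub>v k"
    proof
      assume h: "w - y = 0\<^sub>v k"
      have "w = y"
      proof (intro eq_vecI)
        fix i assume "i < dim_vec y"
        then show "w $ i = y $ i" using arg_cong[OF h, of "\<lambda>v. v $ i"] w y by auto
      qed (use w y in auto)
      with ne show False ..
    qed
    then have "(w - y) \<bullet> (w - y) \<noteq> 0"
      using scalar_prod_self_eq_0[OF _ wy] by blast
    then have "euclid_norm (w - y) \<noteq> 0" by (auto simp: euclid_norm_def)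
    then show ?thesis using expand[OF w] \<mu>
      by (smt (verit) mult_pos_pos zero_le_power2 zero_less_power2)
  qed
  have "is_arg_min (tikhonov_functional T b \<mu>) (\<lambda>y. y \<in> carrier_vec k) w \<longleftrightarrow> w = y" for w
    using less y unfolding is_arg_min_def by (metis less_asym)
  moreover have "(euclid_norm (T *\<^sub>v y - c))\<^sup>2 = tikhonov_phi T b \<mu>"
  proof -
    \<comment> \<open>These are \<open>B^-1 e\<close> and \<open>B^-2 e\<close>. Symmetry of
      \<open>B\<close> gives \<open>e . q = B p . q = p . B q = p . p\<close>, without appeal to
      symmetry of \<open>S\<close>, and \<open>z\<close> is \<open>b\<close> times
      \<open>p\<close>.\<close>
    define p q where "p = S *\<^sub>v e" and "q = S *\<^sub>v p"
    have p: "p \<in> carrier_vec n" and q: "q \<in> carrier_vec n"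
      using S(3) e by (simp_all add: p_def q_def)
    have zp: "z = b \<cdot>\<^sub>v p"
      unfolding z_def c_def p_def by (rule mult_mat_vec[OF S(3) e])
    have "e \<bullet> q = (B *\<^sub>v p) \<bullet> q" unfolding p_def by (simp add: BS[OF e])
    also have "\<dots> = (B *\<^sub>v q) \<bullet> p"
      unfolding B_def shifted_gram_self_adjoint[OF T p q] shifted_gram_self_adjoint[OF T q p]
      using T p q comm_scalar_prod[OF p q]
        comm_scalar_prod[of "transpose_mat T *\<^sub>v p" k "transpose_mat T *\<^sub>v q"] by auto
    also have "B *\<^sub>v q = p" unfolding q_def by (rule BS[OF p])
    finally have eq: "e \<bullet> q = p \<bullet> p" .
    have "(S ^\<^sub>m 2) *\<^sub>v e = q"
      using S(3) e by (simp add: numeral_2_eq_2 p_def q_def)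
    then have "tikhonov_phi T b \<mu> = b\<^sup>2 * (p \<bullet> p)"
      using T S(1) eq unfolding tikhonov_phi_def Let_def B_def e_def by auto
    also have "\<dots> = (euclid_norm (T *\<^sub>v y - c))\<^sup>2"
      unfolding euclid_norm_sq res zp using p by (simp add: power2_eq_square)
    finally show ?thesis ..
  qed
  ultimately show ?thesis using that[of y] y unfolding c_def e_def by blast
qed

section \<open>Tensors and the adjoint of the Stein operator\<close>

text \<open>Multi-indices are lists of fixed length over a finite alphabet. For
  \<open>I = []\<close> the maximum is unspecified, but then only the empty list has to be
  covered.\<close>

lemma finite_multi_indices [simp]: "finite (multi_indices I)"
proof (rule finite_subset)
  show "multi_indices I \<subseteq> {i. set i \<subseteq> {..<Suc (Max (set I))} \<and> length i = length I}"
  proof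
    fix i assume i: "i \<in> multi_indices I"
    have "x < Suc (Max (set I))" if "x \<in> set i" for x
    proof -
      from that obtain n where n: "n < length i" "x = i ! n" by (auto simp: in_set_conv_nth)
      then have "x < I ! n" "I ! n \<in> set I" using i by (auto simp: multi_indices_def)
      then show ?thesis using Max_ge[OF finite_set, of "I ! n" I] by linarith
    qed
    then show "i \<in> {i. set i \<subseteq> {..<Suc (Max (set I))} \<and> length i = length I}"
      using i by (auto simp: multi_indices_def)
  qed
qed (rule finite_lists_length_eq, simp)

lemma multi_indices_update:
  "i \<in> multi_indices I \<Longrightarrow> n < length I \<Longrightarrow> l < I ! n \<Longrightarrow> i[n := l] \<in> multi_indices I"
  by (auto simp: multi_indices_def nth_list_update)

lemma multi_indices_snoc:
  "i @ [j] \<in> multi_indices (I @ [k]) \<longleftrightarrow> i \<in> multi_indices I \<and> j < k"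
  by (auto simp: multi_indices_def nth_append less_Suc_eq)

section \<open>Mode products with square factors: adjoint, commutation, linearity\<close>

lemma mode_product_square:
  assumes "n < length I" "U \<in> carrier_mat (I ! n) (I ! n)"
  shows "mode_product I n X U =
    (\<lambda>i. if i \<in> multi_indices I then \<Sum>l < I ! n. X (i[n := l]) * U $$ (i ! n, l) else 0)"
  using assms by (simp add: mode_product_def)

text \<open>Written as sums over pairs \<open>(i, l)\<close>, the two sides are exchanged by the
  involution that swaps \<open>l\<close> with the entry of \<open>i\<close> at position
  \<open>n\<close>.\<close>

lemma mode_product_adjoint:
  assumes n: "n < length I" and U: "U \<in> carrier_mat (I ! n) (I ! n)"
  shows "tensor_inner I (mode_product I n X U) Y = tensor_inner I X (mode_product I n Y (transpose_mat U))"
proof -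
  let ?S = "multi_indices I \<times> {..<I ! n}"
  have nth: "i ! n < I ! n" "n < length i" if "i \<in> multi_indices I" for i
    using that n by (auto simp: multi_indices_def)
  have "tensor_inner I (mode_product I n X U) Y
      = (\<Sum>i\<in>multi_indices I. \<Sum>l<I ! n. X (i[n := l]) * U $$ (i ! n, l) * Y i)"
    by (simp add: tensor_inner_def mode_product_square[OF n U] sum_distrib_right)
  also have "\<dots> = (\<Sum>(i, l)\<in>?S. X (i[n := l]) * U $$ (i ! n, l) * Y i)"
    by (simp add: sum.cartesian_product)
  also have "\<dots> = (\<Sum>(i, l)\<in>?S. X i * (Y (i[n := l]) * U $$ (l, i ! n)))"
    by (rule sum.reindex_bij_witness[of _ "\<lambda>(i, l). (i[n := l], i ! n)" "\<lambda>(i, l). (i[n := l], i ! n)"])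
       (auto simp: nth n multi_indices_update)
  also have "\<dots> = (\<Sum>i\<in>multi_indices I. \<Sum>l<I ! n. X i * (Y (i[n := l]) * U $$ (l, i ! n)))"
    by (simp add: sum.cartesian_product)
  also have "\<dots> = tensor_inner I X (mode_product I n Y (transpose_mat U))"
    using U n nth
    by (auto simp: tensor_inner_def mode_product_square[of n I "transpose_mat U"] sum_distrib_left
        intro!: sum.cong)
  finally show ?thesis .
qed

text \<open>Distinct modes alter distinct positions of the multi-index. Taking adjoints reverses the
  order of the factors, whereas \<open>stein_adjoint\<close> applies the transposes in the original
  order; commutation reconciles the two.\<close>

lemma mode_product_commute:
  assumes m: "m < length I" and U: "U \<in> carrier_mat (I ! m) (I ! m)"
    and n: "n < length I" and W: "W \<in> carrier_mat (I ! n) (I ! n)" and mn: "m \<noteq> n"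
  shows "mode_product I n (mode_product I m X U) W = mode_product I m (mode_product I n X W) U"
proof
  fix i
  show "mode_product I n (mode_product I m X U) W i = mode_product I m (mode_product I n X W) U i"
  proof (cases "i \<in> multi_indices I")
    case True
    have "mode_product I n (mode_product I m X U) W i
      = (\<Sum>l<I ! n. \<Sum>l'<I ! m. X (i[n := l, m := l']) * U $$ (i ! m, l') * W $$ (i ! n, l))"
      using True mn by (auto simp: mode_product_square[OF n W] mode_product_square[OF m U]
          multi_indices_update n sum_distrib_right)
    also have "\<dots> = (\<Sum>l'<I ! m. \<Sum>l<I ! n. X (i[m := l', n := l]) * W $$ (i ! n, l) * U $$ (i ! m, l'))"
      by (subst sum.swap) (simp add: list_update_swap[OF mn] mult_ac)
    also have "\<dots> = mode_product I m (mode_product I n X W) U i"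
      using True mn by (auto simp: mode_product_square[OF n W] mode_product_square[OF m U]
          multi_indices_update m sum_distrib_right)
    finally show ?thesis .
  qed (simp add: mode_product_square[OF n W] mode_product_square[OF m U])
qed

lemma mode_product_linear:
  "mode_product I n (\<lambda>i. c * X i + d * Y i) U
    = (\<lambda>i. c * mode_product I n X U i + d * mode_product I n Y U i)"
  by (auto simp: mode_product_def fun_eq_iff sum_distrib_left sum.distrib algebra_simps)

definition square_factors :: "nat list \<Rightarrow> real mat list \<Rightarrow> bool" where
  "square_factors I A \<longleftrightarrow> length A = length I \<and> (\<forall>n < length I. A ! n \<in> carrier_mat (I ! n) (I ! n))"

lemma multi_mode_product_adjoint:
  assumes A: "square_factors I A"
  shows "tensor_inner I (multi_mode_product I A X) Y
    = tensor_inner I X (multi_mode_product I (map transpose_mat A) Y)"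
proof -
  define f where "f = (\<lambda>Z n. mode_product I n Z (A ! n))"
  define g where "g = (\<lambda>Z n. mode_product I n Z (map transpose_mat A ! n))"
  have sq: "A ! n \<in> carrier_mat (I ! n) (I ! n)" "map transpose_mat A ! n = transpose_mat (A ! n)"
    if "n < length I" for n using that A by (auto simp: square_factors_def)
  \<comment> \<open>A factor may be pulled through the factors of all other modes, so the last one
    can be applied first.\<close>
  have comm: "g (foldl g Y ns) n = foldl g (g Y n) ns"
    if "n < length I" "set ns \<subseteq> {..<length I}" "n \<notin> set ns" for Y n ns
    using that(2,3)
  proof (induction ns arbitrary: Y)
    case (Cons m ns)
    have "g (g Y m) n = g (g Y n) m"
      unfolding g_def using Cons.prems that(1) by (intro mode_product_commute) (auto simp: sq)
    then show ?case using Cons by simp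
  qed simp
  \<comment> \<open>The induction removes the last mode, and \<open>Y\<close> is arbitrary because
    the transpose of the removed factor is absorbed into it.\<close>
  have "tensor_inner I (foldl f X ns) Y = tensor_inner I X (foldl g Y ns)"
    if "set ns \<subseteq> {..<length I}" "distinct ns" for Y ns
    using that
  proof (induction ns arbitrary: Y rule: rev_induct)
    case (snoc n ns)
    have n: "n < length I" using snoc.prems by auto
    have "tensor_inner I (foldl f X (ns @ [n])) Y = tensor_inner I (foldl f X ns) (g Y n)"
      unfolding g_def f_def by (simp add: sq n mode_product_adjoint)
    also have "\<dots> = tensor_inner I X (foldl g (g Y n) ns)"
      using snoc by simp
    also have "foldl g (g Y n) ns = foldl g Y (ns @ [n])"
      using comm[OF n, of ns Y] snoc.prems by simp
    finally show ?case .
  qed simp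
  then show ?thesis unfolding multi_mode_product_def f_def g_def by (simp add: lessThan_atLeast0)
qed

lemma multi_mode_product_linear:
  "multi_mode_product I A (\<lambda>i. c * X i + d * Y i)
    = (\<lambda>i. c * multi_mode_product I A X i + d * multi_mode_product I A Y i)"
proof -
  have "foldl (\<lambda>Y n. mode_product I n Y (A ! n)) (\<lambda>i. c * X i + d * Y i) ns
    = (\<lambda>i. c * foldl (\<lambda>Y n. mode_product I n Y (A ! n)) X ns i
         + d * foldl (\<lambda>Y n. mode_product I n Y (A ! n)) Y ns i)" for ns
    by (induction ns arbitrary: X Y) (simp_all add: mode_product_linear)
  then show ?thesis by (simp add: multi_mode_product_def)
qed

lemma multi_mode_product_carrier:
  assumes A: "square_factors I A" and X: "X \<in> carrier_tensor I"
  shows "multi_mode_product I A X \<in> carrier_tensor I"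
proof -
  have "foldl (\<lambda>Y n. mode_product I n Y (A ! n)) X ns \<in> carrier_tensor I"
    if "set ns \<subseteq> {..<length I}" for ns
    using that
  proof (induction ns rule: rev_induct)
    case (snoc n ns)
    then have "n < length I" "A ! n \<in> carrier_mat (I ! n) (I ! n)"
      using A by (auto simp: square_factors_def)
    then show ?case by (simp add: mode_product_square carrier_tensor_def)
  qed (use X in simp)
  then show ?thesis by (simp add: multi_mode_product_def lessThan_atLeast0)
qed

lemma square_factors_transpose: "square_factors I A \<Longrightarrow> square_factors I (map transpose_mat A)"
  by (auto simp: square_factors_def)

section \<open>Bilinearity of the inner product; adjointness and linearity of the Stein
  operator\<close>

lemma tensor_inner_commute: "tensor_inner I X Y = tensor_inner I Y X"
  by (simp add: tensor_inner_def mult.commute)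

lemma tensor_inner_minus_left: "tensor_inner I (tensor_minus X Y) Z = tensor_inner I X Z - tensor_inner I Y Z"
  by (simp add: tensor_inner_def tensor_minus_def sum_subtractf algebra_simps)

lemma tensor_inner_minus_right: "tensor_inner I Z (tensor_minus X Y) = tensor_inner I Z X - tensor_inner I Z Y"
  by (simp add: tensor_inner_def tensor_minus_def sum_subtractf algebra_simps)

lemma tensor_inner_scale_left: "tensor_inner I (tensor_scale c X) Z = c * tensor_inner I X Z"
  by (simp add: tensor_inner_def tensor_scale_def sum_distrib_left algebra_simps)

lemma tensor_inner_scale_right: "tensor_inner I Z (tensor_scale c X) = c * tensor_inner I Z X"
  by (simp add: tensor_inner_def tensor_scale_def sum_distrib_left algebra_simps)

lemma tensor_norm_sq: "(tensor_norm I X)\<^sup>2 = tensor_inner I X X"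
  by (simp add: tensor_norm_def tensor_inner_def sum_nonneg)

lemma tensor_inner_normalized:
  assumes "tensor_norm I X \<noteq> 0"
  shows "tensor_inner I (tensor_scale (1 / tensor_norm I X) X) (tensor_scale (1 / tensor_norm I X) X) = 1"
  unfolding tensor_inner_scale_left tensor_inner_scale_right
  unfolding tensor_norm_sq[symmetric]
  using assms by (simp add: power2_eq_square)

lemma tensor_minus_carrier:
  "X \<in> carrier_tensor I \<Longrightarrow> Y \<in> carrier_tensor I \<Longrightarrow> tensor_minus X Y \<in> carrier_tensor I"
  by (simp add: carrier_tensor_def tensor_minus_def)

lemma tensor_scale_carrier: "X \<in> carrier_tensor I \<Longrightarrow> tensor_scale c X \<in> carrier_tensor I"
  by (simp add: carrier_tensor_def tensor_scale_def)

lemma stein_adjoint_adjoint: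
  assumes "square_factors I A"
  shows "tensor_inner I (stein_op I A X) Y = tensor_inner I X (stein_adjoint I A Y)"
  using assms by (simp add: stein_op_def stein_adjoint_def tensor_inner_minus_left
      tensor_inner_minus_right multi_mode_product_adjoint)

lemma stein_op_linear:
  "stein_op I A (\<lambda>i. c * X i + d * Y i) = (\<lambda>i. c * stein_op I A X i + d * stein_op I A Y i)"
  by (simp add: stein_op_def tensor_minus_def multi_mode_product_linear algebra_simps)

lemma stein_op_sum:
  fixes k :: nat
  shows "stein_op I A (\<lambda>i. \<Sum>j<k. y j * X j i) = (\<lambda>i. \<Sum>j<k. y j * stein_op I A (X j) i)"
proof (induction k)
  case 0
  \<comment> \<open>With both coefficients zero, linearity says that the zero tensor is mapped to
    zero.\<close>
  show ?case using stein_op_linear[of I A 0 "\<lambda>_. 0" 0 "\<lambda>_. 0"] by simp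
next
  case (Suc k)
  show ?case
    using stein_op_linear[of I A 1 "\<lambda>i. \<Sum>j<k. y j * X j i" "y k" "X k"] Suc by simp
qed

section \<open>The bidiagonalization process\<close>

text \<open>
  The two recurrences determine \<open>\<langle>v\<^sub>j\<^sub>+\<^sub>1, v\<^sub>i\<rangle>\<close> from \<open>\<langle>M u\<^sub>j, v\<^sub>i\<rangle> = \<langle>u\<^sub>j, M' v\<^sub>i\<rangle>\<close> and the
  orthonormality of the \<open>u\<close>, and symmetrically with the roles exchanged, so that both families have to
  be treated in the same induction.
\<close>

lemma bidiagonalization_orthonormal:
  assumes adj: "\<And>X Y. tensor_inner I (M X) Y = tensor_inner I X (M' Y)"
    and v0: "M' (v 0) = tensor_scale (a 0) (u 0)"
    and M: "\<And>j. j < m \<Longrightarrow>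
      tensor_minus (M (u j)) (tensor_scale (a j) (v j)) = tensor_scale (b (Suc j)) (v (Suc j))"
    and M': "\<And>j. j < m \<Longrightarrow>
      tensor_minus (M' (v (Suc j))) (tensor_scale (b (Suc j)) (u j)) = tensor_scale (a (Suc j)) (u (Suc j))"
    and nz: "\<And>j. j \<le> m \<Longrightarrow> a j \<noteq> 0 \<and> b j \<noteq> 0"
    and unit: "\<And>j. j \<le> m \<Longrightarrow> tensor_inner I (v j) (v j) = 1 \<and> tensor_inner I (u j) (u j) = 1"
  shows "i \<le> m \<Longrightarrow> j \<le> m \<Longrightarrow> tensor_inner I (v i) (v j) = of_bool (i = j)"
proof -
  let ?P = "\<lambda>x i j. tensor_inner I (x i) (x j) = of_bool (i = j)"
  have "j \<le> m \<Longrightarrow> \<forall>i\<le>j. \<forall>i'\<le>j. ?P v i i' \<and> ?P u i i'" for j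
  proof (induction j)
    case 0
    then show ?case using unit by simp
  next
    case (Suc j)
    then have IH: "?P v i i'" "?P u i i'" if "i \<le> j" "i' \<le> j" for i i' using that by auto
    have j: "j < m" using Suc.prems by simp
    have v: "tensor_inner I (v (Suc j)) (v i) = 0" if i: "i \<le> j" for i
    proof -
      \<comment> \<open>The recurrence for \<open>M'\<close> expresses \<open>M' (v i)\<close> by
        \<open>u i\<close> and, for positive \<open>i\<close>, also \<open>u (i - 1)\<close>. Since
        \<open>i - 1 < j\<close>, only \<open>u i\<close> can contribute.\<close>
      have *: "tensor_inner I (u j) (M' (v i)) = a j * of_bool (i = j)"
      proof (cases i)
        case 0
        then show ?thesis using IH(2)[of j 0] by (cases "j = 0") (simp_all add: v0 tensor_inner_scale_right)
      next
        case (Suc i')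
        have "tensor_inner I (u j) (tensor_minus (M' (v i)) (tensor_scale (b i) (u i')))
            = tensor_inner I (u j) (tensor_scale (a i) (u i))"
          using M'[of i'] Suc i j by simp
        then show ?thesis
          using IH[of j i] IH[of j i'] Suc i
          by (auto simp: tensor_inner_scale_right tensor_inner_minus_right)
      qed
      have "b (Suc j) * tensor_inner I (v (Suc j)) (v i)
          = tensor_inner I (u j) (M' (v i)) - a j * tensor_inner I (v j) (v i)"
        unfolding adj[symmetric] tensor_inner_scale_left[symmetric] M[OF j, symmetric]
          tensor_inner_minus_left ..
      \<comment> \<open>For \<open>i = j\<close> the two terms equal to \<open>a j\<close> cancel,
        for \<open>i < j\<close> both vanish; then divide by \<open>b (Suc j)\<close>.\<close>
      then show ?thesis using * IH(1)[of j i] i nz[of "Suc j"] j by (cases "i = j") auto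
    qed
    have u: "tensor_inner I (u (Suc j)) (u i) = 0" if i: "i \<le> j" for i
    proof -
      have "tensor_inner I (tensor_minus (M (u i)) (tensor_scale (a i) (v i))) (v (Suc j))
            = b (Suc i) * tensor_inner I (v (Suc j)) (v (Suc i))"
        using M[of i] i j
        by (simp add: tensor_inner_scale_left tensor_inner_commute[of I "v (Suc i)" "v (Suc j)"])
      \<comment> \<open>The family \<open>v\<close> has already been extended to
        \<open>Suc j\<close>: for \<open>i < j\<close> the fact just proved applies to
        \<open>v (Suc i)\<close>, for \<open>i = j\<close> the value is a squared unit norm.\<close>
      moreover have "tensor_inner I (v (Suc j)) (v (Suc i)) = of_bool (i = j)"
        using v[of "Suc i"] i unit[of "Suc j"] j by (cases "i = j") auto
      ultimately have *: "tensor_inner I (M (u i)) (v (Suc j)) = b (Suc i) * of_bool (i = j)"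
        using v[OF i] tensor_inner_commute[of I "v i" "v (Suc j)"]
        by (simp add: tensor_inner_minus_left tensor_inner_scale_left)
      have "a (Suc j) * tensor_inner I (u (Suc j)) (u i)
          = tensor_inner I (M' (v (Suc j))) (u i) - b (Suc j) * tensor_inner I (u j) (u i)"
        unfolding tensor_inner_scale_left[symmetric] M'[OF j, symmetric]
          tensor_inner_minus_left ..
      also have "tensor_inner I (M' (v (Suc j))) (u i) = tensor_inner I (M (u i)) (v (Suc j))"
        by (simp add: adj tensor_inner_commute)
      finally show ?thesis using * IH(2)[of j i] i nz[of "Suc j"] j by (cases "i = j") auto
    qed
    show ?case
    proof (intro allI impI)
      fix i i' assume "i \<le> Suc j" "i' \<le> Suc j"
      then show "?P v i i' \<and> ?P u i i'"
        using IH[of i i'] u[of i] u[of i'] v[of i] v[of i'] unit[of "Suc j"] j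
          tensor_inner_commute[of I "v i" "v i'"] tensor_inner_commute[of I "u i" "u i'"]
        by (auto simp: le_Suc_eq)
    qed
  qed
  then show "i \<le> m \<Longrightarrow> j \<le> m \<Longrightarrow> tensor_inner I (v i) (v j) = of_bool (i = j)" by blast
qed

text \<open>Parseval's identity, by which the tensor norm of the residual becomes the Euclidean norm
  of its coordinate vector.\<close>

lemma tensor_inner_sum_orthonormal:
  fixes n :: nat
  assumes "\<And>i j. i < n \<Longrightarrow> j < n \<Longrightarrow> tensor_inner I (v i) (v j) = of_bool (i = j)"
  shows "tensor_inner I (\<lambda>x. \<Sum>j<n. c j * v j x) (\<lambda>x. \<Sum>j<n. c j * v j x) = (\<Sum>j<n. c j * c j)"
proof -
  have "tensor_inner I (\<lambda>x. \<Sum>j<n. c j * v j x) (\<lambda>x. \<Sum>j<n. c j * v j x)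
      = (\<Sum>x\<in>multi_indices I. \<Sum>i<n. \<Sum>j<n. c i * c j * (v i x * v j x))"
    by (simp add: tensor_inner_def sum_product mult_ac)
  also have "\<dots> = (\<Sum>i<n. \<Sum>x\<in>multi_indices I. \<Sum>j<n. c i * c j * (v i x * v j x))"
    by (rule sum.swap)
  also have "\<dots> = (\<Sum>i<n. \<Sum>j<n. c i * c j * tensor_inner I (v i) (v j))"
    unfolding tensor_inner_def sum_distrib_left by (intro sum.cong refl sum.swap)
  also have "\<dots> = (\<Sum>i<n. \<Sum>j<n. if i = j then c i * c j else 0)"
    by (intro sum.cong refl) (simp add: assms)
  also have "\<dots> = (\<Sum>j<n. c j * c j)"
    by (simp add: sum.delta')
  finally show ?thesis .
qed

text \<open>Membership in the carrier guarantees that the truncation in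
  \<open>tensor_of_slices\<close> discards no nonzero entry of the tensors used as slices.\<close>

lemma gkb_step_carrier:
  assumes M: "\<And>X. X \<in> carrier_tensor I \<Longrightarrow> M X \<in> carrier_tensor I"
    and M': "\<And>X. X \<in> carrier_tensor I \<Longrightarrow> M' X \<in> carrier_tensor I"
    and F: "F \<in> carrier_tensor I"
  shows "fst (snd (gkb_step I M M' F j)) \<in> carrier_tensor I \<and>
    snd (snd (snd (gkb_step I M M' F j))) \<in> carrier_tensor I"
proof (induction j)
  case 0
  show ?case by (simp add: Let_def tensor_scale_carrier M' F)
next
  case (Suc j)
  then show ?case
    by (cases "gkb_step I M M' F j" rule: prod_cases4)
       (simp add: Let_def tensor_minus_carrier tensor_scale_carrier M M')
qed

lemma tensor_scale_normalized:
  "c \<noteq> 0 \<Longrightarrow> tensor_scale c (tensor_scale (1 / c) Z) = Z"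
  by (simp add: tensor_scale_def)

section \<open>The process in its own numbering: recurrences, orthonormality, residual\<close>

context
  fixes I :: "nat list" and M M' :: "tensor \<Rightarrow> tensor" and F :: tensor and k :: nat
begin

lemma gkb_V_one:
  assumes "gkb_beta I M M' F 1 \<noteq> 0"
  shows "F = tensor_scale (gkb_beta I M M' F 1) (gkb_V I M M' F 1)"
    and "tensor_inner I (gkb_V I M M' F 1) (gkb_V I M M' F 1) = 1"
  using assms by (simp_all add: gkb_beta_def gkb_V_def Let_def tensor_scale_normalized tensor_inner_normalized)

lemma gkb_U_one:
  assumes "gkb_alpha I M M' F 1 \<noteq> 0"
  shows "M' (gkb_V I M M' F 1) = tensor_scale (gkb_alpha I M M' F 1) (gkb_U I M M' F 1)"
    and "tensor_inner I (gkb_U I M M' F 1) (gkb_U I M M' F 1) = 1"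
  using assms by (simp_all add: gkb_alpha_def gkb_V_def gkb_U_def Let_def tensor_scale_normalized
      tensor_inner_normalized)

text \<open>Multiplying back by the nonzero norm turns the normalization in \<open>gkb_step\<close>
  into a recurrence without division.\<close>

lemma gkb_V_Suc:
  assumes "gkb_beta I M M' F (Suc (Suc j)) \<noteq> 0"
  shows "tensor_minus (M (gkb_U I M M' F (Suc j)))
      (tensor_scale (gkb_alpha I M M' F (Suc j)) (gkb_V I M M' F (Suc j)))
    = tensor_scale (gkb_beta I M M' F (Suc (Suc j))) (gkb_V I M M' F (Suc (Suc j)))"
    and "tensor_inner I (gkb_V I M M' F (Suc (Suc j))) (gkb_V I M M' F (Suc (Suc j))) = 1"
  using assms
  by (cases "gkb_step I M M' F j" rule: prod_cases4;
      simp add: gkb_beta_def gkb_alpha_def gkb_V_def gkb_U_def Let_def tensor_scale_normalized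
        tensor_inner_normalized)+

lemma gkb_U_Suc:
  assumes "gkb_alpha I M M' F (Suc (Suc j)) \<noteq> 0"
  shows "tensor_minus (M' (gkb_V I M M' F (Suc (Suc j))))
      (tensor_scale (gkb_beta I M M' F (Suc (Suc j))) (gkb_U I M M' F (Suc j)))
    = tensor_scale (gkb_alpha I M M' F (Suc (Suc j))) (gkb_U I M M' F (Suc (Suc j)))"
    and "tensor_inner I (gkb_U I M M' F (Suc (Suc j))) (gkb_U I M M' F (Suc (Suc j))) = 1"
  using assms
  by (cases "gkb_step I M M' F j" rule: prod_cases4;
      simp add: gkb_beta_def gkb_alpha_def gkb_V_def gkb_U_def Let_def tensor_scale_normalized
        tensor_inner_normalized)+

text \<open>An instance of the abstract induction with indices shifted by one: the tensors numbered
  \<open>1\<close> to \<open>k + 1\<close> become the families on \<open>0\<close> to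
  \<open>k\<close>.\<close>

lemma gkb_V_orthonormal:
  assumes adj: "\<And>X Y. tensor_inner I (M X) Y = tensor_inner I X (M' Y)"
    and nb: "gkb_no_breakdown I M M' F (Suc k)" and "i \<le> k" "j \<le> k"
  shows "tensor_inner I (gkb_V I M M' F (Suc i)) (gkb_V I M M' F (Suc j)) = of_bool (i = j)"
proof (rule bidiagonalization_orthonormal[where u = "\<lambda>j. gkb_U I M M' F (Suc j)"
      and a = "\<lambda>j. gkb_alpha I M M' F (Suc j)" and b = "\<lambda>j. gkb_beta I M M' F (Suc j)", OF adj])
  have nz: "gkb_alpha I M M' F (Suc j) \<noteq> 0" "gkb_beta I M M' F (Suc j) \<noteq> 0" if "j \<le> k" for j
    using nb that by (auto simp: gkb_no_breakdown_def)
  show "tensor_inner I (gkb_V I M M' F (Suc j)) (gkb_V I M M' F (Suc j)) = 1 \<and>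
      tensor_inner I (gkb_U I M M' F (Suc j)) (gkb_U I M M' F (Suc j)) = 1" if "j \<le> k" for j
    using nz[OF that] gkb_V_one(2) gkb_U_one(2) gkb_V_Suc(2) gkb_U_Suc(2) by (cases j) auto
  show "M' (gkb_V I M M' F (Suc 0)) = tensor_scale (gkb_alpha I M M' F (Suc 0)) (gkb_U I M M' F (Suc 0))"
    using gkb_U_one(1) nz[of 0] by simp
qed (use assms gkb_V_Suc(1) gkb_U_Suc(1) in \<open>auto simp: gkb_no_breakdown_def\<close>)

text \<open>When \<open>x\<close> lists the values of the tensors \<open>gkb_V\<close> at one
  position, the right-hand side is what the recurrence gives for \<open>M\<close> applied to
  \<open>gkb_U\<close> with index \<open>Suc j\<close>.\<close>

lemma gkb_T_column:
  assumes "j < k"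
  shows "(\<Sum>i<Suc k. gkb_T I M M' F k $$ (i, j) * x i)
    = gkb_alpha I M M' F (Suc j) * x j + gkb_beta I M M' F (Suc (Suc j)) * x (Suc j)"
proof -
  have "(\<Sum>i<Suc k. gkb_T I M M' F k $$ (i, j) * x i)
      = (\<Sum>i<Suc k. (if i = j then gkb_alpha I M M' F (Suc j) * x i else 0)
          + (if i = Suc j then gkb_beta I M M' F (Suc (Suc j)) * x i else 0))"
    using assms by (intro sum.cong refl) (auto simp: gkb_T_def)
  also have "\<dots> = gkb_alpha I M M' F (Suc j) * x j + gkb_beta I M M' F (Suc (Suc j)) * x (Suc j)"
    unfolding sum.distrib using assms by (simp only: sum.delta finite_lessThan) auto
  finally show ?thesis .
qed

text \<open>Replaces the contraction by a plain linear combination, to which linearity of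
  \<open>M\<close> applies; outside the index set both sides vanish.\<close>

lemma gkb_iterate_eq_sum:
  assumes "\<And>j. gkb_U I M M' F j \<in> carrier_tensor I" and "y \<in> carrier_vec k"
  shows "gkb_iterate I M M' F k y = (\<lambda>i. \<Sum>j<k. y $ j * gkb_U I M M' F (Suc j) i)"
proof
  fix i
  have "gkb_U I M M' F (Suc j) i = 0" if "i \<notin> multi_indices I" for j
    using assms(1)[of "Suc j"] that by (simp add: carrier_tensor_def)
  then show "gkb_iterate I M M' F k y i = (\<Sum>j<k. y $ j * gkb_U I M M' F (Suc j) i)"
    using assms(2) by (auto simp: gkb_iterate_def contract_last_def frontal_slice_def
        tensor_of_slices_def multi_indices_snoc intro!: sum.cong)
qed

lemma gkb_residual_norm:
  assumes adj: "\<And>X Y. tensor_inner I (M X) Y = tensor_inner I X (M' Y)"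
    and lin: "\<And>y X. M (\<lambda>i. \<Sum>j<k. y j * X j i) = (\<lambda>i. \<Sum>j<k. y j * M (X j) i)"
    and U: "\<And>j. gkb_U I M M' F j \<in> carrier_tensor I"
    and nb: "gkb_no_breakdown I M M' F (Suc k)"
    and y: "y \<in> carrier_vec k"
  shows "tensor_norm I (tensor_minus (M (gkb_iterate I M M' F k y)) F)
    = euclid_norm (gkb_T I M M' F k *\<^sub>v y - tensor_norm I F \<cdot>\<^sub>v unit_vec (Suc k) 0)"
proof -
  define T where "T = gkb_T I M M' F k"
  define r where "r = T *\<^sub>v y - tensor_norm I F \<cdot>\<^sub>v unit_vec (Suc k) 0"
  define v where "v = (\<lambda>j. gkb_V I M M' F (Suc j))"
  have T: "T \<in> carrier_mat (Suc k) k" by (simp add: T_def gkb_T_def)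
  have \<beta>: "tensor_norm I F = gkb_beta I M M' F 1" by (simp add: gkb_beta_def Let_def)
  have nz: "gkb_beta I M M' F (Suc j) \<noteq> 0" if "j \<le> k" for j
    using nb that by (auto simp: gkb_no_breakdown_def)
  have Fx: "F x = tensor_norm I F * v 0 x" for x
    using arg_cong[OF gkb_V_one(1), of "\<lambda>G. G x"] nz[of 0]
    by (simp add: \<beta> v_def tensor_scale_def)
  have MU: "M (gkb_U I M M' F (Suc j)) x = (\<Sum>i<Suc k. T $$ (i, j) * v i x)" if "j < k" for j x
    using arg_cong[OF gkb_V_Suc(1)[of j], of "\<lambda>G. G x"] nz[of "Suc j"] that
    unfolding T_def gkb_T_column[OF that]
    by (simp add: v_def tensor_minus_def tensor_scale_def)
  have rj: "r $ i = (\<Sum>j<k. T $$ (i, j) * y $ j) - tensor_norm I F * of_bool (i = 0)" if "i < Suc k" for i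
    using that T y by (auto simp: r_def scalar_prod_def atLeast0LessThan unit_vec_def)
  have "tensor_minus (M (gkb_iterate I M M' F k y)) F = (\<lambda>x. \<Sum>i<Suc k. r $ i * v i x)"
  proof
    fix x
    \<comment> \<open>After exchanging the sums, each column of \<open>T\<close> is collected into
      the image of one \<open>gkb_U\<close>, and the term subtracted at \<open>i = 0\<close> is
      \<open>F x\<close>.\<close>
    have "(\<Sum>i<Suc k. r $ i * v i x)
        = (\<Sum>i<Suc k. (\<Sum>j<k. T $$ (i, j) * y $ j * v i x) - (if i = 0 then tensor_norm I F * v i x else 0))"
      by (intro sum.cong refl) (auto simp: rj left_diff_distrib sum_distrib_right)
    also have "\<dots> = (\<Sum>j<k. \<Sum>i<Suc k. T $$ (i, j) * y $ j * v i x) - tensor_norm I F * v 0 x"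
      unfolding sum_subtractf by (subst sum.swap) (simp only: sum.delta finite_lessThan, simp)
    also have "(\<Sum>j<k. \<Sum>i<Suc k. T $$ (i, j) * y $ j * v i x)
        = (\<Sum>j<k. y $ j * M (gkb_U I M M' F (Suc j)) x)"
      by (intro sum.cong refl) (simp add: MU sum_distrib_left algebra_simps del: sum.lessThan_Suc)
    finally show "tensor_minus (M (gkb_iterate I M M' F k y)) F x = (\<Sum>i<Suc k. r $ i * v i x)"
      unfolding tensor_minus_def gkb_iterate_eq_sum[OF U y] lin Fx[of x] by (rule sym)
  qed
  moreover have "tensor_inner I (\<lambda>x. \<Sum>i<Suc k. r $ i * v i x) (\<lambda>x. \<Sum>i<Suc k. r $ i * v i x)
      = (\<Sum>i<Suc k. r $ i * r $ i)"
    by (rule tensor_inner_sum_orthonormal) (simp add: v_def gkb_V_orthonormal[OF adj nb])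
  moreover have "(\<Sum>i<Suc k. r $ i * r $ i) = r \<bullet> r"
    using T y by (simp add: scalar_prod_def r_def atLeast0LessThan)
  ultimately show ?thesis
    unfolding T_def[symmetric] r_def[symmetric] euclid_norm_def by (simp only: tensor_norm_def)
qed

end

section \<open>Bounds for the projected residual and for the tensor residual\<close>

theorem proposition3p3:
  fixes I :: "nat list" and A :: "real mat list" and F :: tensor and k :: nat
    and \<mu> \<eta> \<epsilon> :: real
  defines "M \<equiv> stein_op I A" and "M' \<equiv> stein_adjoint I A"
  defines "\<beta>\<^sub>1 \<equiv> tensor_norm I F" and "T \<equiv> gkb_T I M M' F k"
  assumes "length A = length I"
    and "\<And>n. n < length I \<Longrightarrow> A ! n \<in> carrier_mat (I ! n) (I ! n)"
    and "F \<in> carrier_tensor I"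
    and "k \<ge> 1"
    and "gkb_no_breakdown I M M' F (k + 1)"
    and "\<epsilon> > 0" and "\<eta> > 1"
    and "\<mu> > 0"
    and "\<epsilon>\<^sup>2 \<le> tikhonov_phi T \<beta>\<^sub>1 \<mu>" and "tikhonov_phi T \<beta>\<^sub>1 \<mu> \<le> \<eta>\<^sup>2 * \<epsilon>\<^sup>2"
  shows "(\<exists>!y. is_arg_min (tikhonov_functional T \<beta>\<^sub>1 \<mu>) (\<lambda>y. y \<in> carrier_vec k) y) \<and>
    (\<forall>y. is_arg_min (tikhonov_functional T \<beta>\<^sub>1 \<mu>) (\<lambda>y. y \<in> carrier_vec k) y \<longrightarrow>
       \<epsilon> \<le> euclid_norm (T *\<^sub>v y - \<beta>\<^sub>1 \<cdot>\<^sub>v unit_vec (k + 1) 0) \<and>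
       euclid_norm (T *\<^sub>v y - \<beta>\<^sub>1 \<cdot>\<^sub>v unit_vec (k + 1) 0) \<le> \<eta> * \<epsilon> \<and>
       \<epsilon> \<le> tensor_norm I (tensor_minus (M (gkb_iterate I M M' F k y)) F) \<and>
       tensor_norm I (tensor_minus (M (gkb_iterate I M M' F k y)) F) \<le> \<eta> * \<epsilon>)"
proof -
  have A: "square_factors I A" using assms(5,6) by (simp add: square_factors_def)
  have T: "T \<in> carrier_mat (k + 1) k" by (simp add: T_def gkb_T_def)
  obtain y where y: "y \<in> carrier_vec k"
    and phi: "(euclid_norm (T *\<^sub>v y - \<beta>\<^sub>1 \<cdot>\<^sub>v unit_vec (k + 1) 0))\<^sup>2 = tikhonov_phi T \<beta>\<^sub>1 \<mu>"
    and min: "\<forall>w. is_arg_min (tikhonov_functional T \<beta>\<^sub>1 \<mu>) (\<lambda>y. y \<in> carrier_vec k) w \<longleftrightarrow> w = y"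
    by (rule tikhonov_unique_minimizer[OF T \<open>\<mu> > 0\<close>, of \<beta>\<^sub>1])
  have "\<epsilon> \<le> euclid_norm (T *\<^sub>v y - \<beta>\<^sub>1 \<cdot>\<^sub>v unit_vec (k + 1) 0)"
    using assms(13) unfolding phi[symmetric] by (rule power2_le_imp_le) (rule euclid_norm_nonneg)
  moreover have "euclid_norm (T *\<^sub>v y - \<beta>\<^sub>1 \<cdot>\<^sub>v unit_vec (k + 1) 0) \<le> \<eta> * \<epsilon>"
    using assms(14) unfolding phi[symmetric] power_mult_distrib[symmetric]
    by (rule power2_le_imp_le) (use assms(10,11) in simp)
  \<comment> \<open>Index \<open>0\<close> is covered as well: \<open>0 - 1 = 0\<close> on naturals,
    so it denotes the same tensor as index \<open>1\<close>.\<close>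
  moreover have "gkb_U I M M' F j \<in> carrier_tensor I" for j
  proof -
    have "M X \<in> carrier_tensor I" "M' X \<in> carrier_tensor I" if "X \<in> carrier_tensor I" for X
      using that A by (simp_all add: M_def M'_def stein_op_def stein_adjoint_def
          tensor_minus_carrier multi_mode_product_carrier square_factors_transpose)
    then show ?thesis
      unfolding gkb_U_def using assms(7) by (intro conjunct2[OF gkb_step_carrier])
  qed
  \<comment> \<open>The two residual norms coincide, so the bounds for the first carry over
    unchanged.\<close>
  then have "tensor_norm I (tensor_minus (M (gkb_iterate I M M' F k y)) F)
      = euclid_norm (T *\<^sub>v y - \<beta>\<^sub>1 \<cdot>\<^sub>v unit_vec (k + 1) 0)"
    unfolding T_def \<beta>\<^sub>1_def Suc_eq_plus1[symmetric]
    by (intro gkb_residual_norm y assms(9)[unfolded Suc_eq_plus1[symmetric]])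
       (simp_all only: M_def M'_def stein_adjoint_adjoint[OF A] stein_op_sum)
  ultimately show ?thesis
    by (simp add: min)
qed

end
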